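(* Let $L_\Psi>0$ and $x_0,x^*\in\mathbb{R}^{q+1}$. Let $(\alpha_k)_{k\ge1},(\delta_k)_{k\ge1},(\omega_k)_{k\ge 1}$ satisfy $\alpha_1=1$, $0<\alpha_k<1$ for $k\ge2$, $\delta_k>0$, $\omega_k>0$, and, with $\Gamma_1=1$ and $\Gamma_k=(1-\alpha_k)\Gamma_{k-1}$ for $k\ge2$, $$\alpha_k\delta_k\le\omega_k<\frac1{L_\Psi}\quad\text{and}\quad \frac{\alpha_k}{\delta_k\Gamma_k}\ge\frac{\alpha_{k+1}}{\delta_{k+1}\Gamma_{k+1}}\qquad\text{for all }k\ge1.$$ Assume further that $\delta_1=\omega_k=\omega$ for all $k$, for some constant $\omega>0$, and that $h=0$ (so $L_h=0$). Then the complexity upper bound $$\left[\sum_{k=1}^{N}\Gamma_k^{-1}\omega_k(1-L_\Psi\omega_k)\right]^{-1}\left[\frac{\|x_0-x^*\|^2}{\delta_1}+\frac{2L_h}{\Gamma_N}\left(\|x^*\|^2+M^2\right)\right]$$ is $O(1/N)$ as $N\to\infty$.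
   Context: Setting: the composite problem $\min_{x\in\mathbb{R}^{q+1}}\Psi(x)+\chi(x)$, $\Psi=f+h$, where $f$ is convex with $L_f$-Lipschitz gradient, $h$ is possibly nonconvex with $L_h$-Lipschitz gradient, $\chi$ is convex over a bounded domain, and $L_\Psi$ is a Lipschitz constant of $\nabla\Psi$. The accelerated gradient algorithm for this problem has hyperparameters $\alpha_k$ (damping), $\omega_k$ and $\delta_k$ (step sizes), starting point $x_0$; $x^*$ is a solution and $M$ a constant. The displayed expression is the known upper bound on the minimal squared norm of the generalized gradient over the first $N$ iterations. *)

theory Defs
  imports "HOL-Analysis.Analysis" "HOL-Library.Landau_Symbols"
begin

definition has_lipschitz_gradient :: "real \<Rightarrow> ('a::real_inner \<Rightarrow> real) \<Rightarrow> bool"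
  where "has_lipschitz_gradient L f \<longleftrightarrow>
    (\<exists>g. (\<forall>x. GDERIV f x :> g x) \<and> L-lipschitz_on UNIV g)"

text \<open>
  Sequences are indexed from 1; their values at 0 are irrelevant.  The arguments
  \<open>\<delta>\<close>, \<open>\<omega>\<close>, \<open>\<Gamma>\<close> are whole sequences, and the bound is a function of the
  iteration count \<open>N\<close>.
\<close>

definition complexity_bound ::
  "real \<Rightarrow> real \<Rightarrow> real \<Rightarrow> (nat \<Rightarrow> real) \<Rightarrow> (nat \<Rightarrow> real) \<Rightarrow> (nat \<Rightarrow> real) \<Rightarrow>
    'a::real_normed_vector \<Rightarrow> 'a \<Rightarrow> nat \<Rightarrow> real"
  where "complexity_bound L\<^sub>\<Psi> L\<^sub>h M \<delta> \<omega> \<Gamma> x\<^sub>0 x\<^sub>s N =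
    inverse (\<Sum>k=1..N. inverse (\<Gamma> k) * \<omega> k * (1 - L\<^sub>\<Psi> * \<omega> k)) *
      ((norm (x\<^sub>0 - x\<^sub>s))\<^sup>2 / \<delta> 1 + 2 * L\<^sub>h / \<Gamma> N * ((norm x\<^sub>s)\<^sup>2 + M\<^sup>2))"

end

theory Submission imports Defs begin

text \<open>
  Since \<open>\<Gamma> k \<in> (0, 1]\<close>, every summand in the denominator of the bound is at least the
  constant \<open>c * (1 - L\<^sub>\<Psi> * c) > 0\<close>, so the sum grows at least linearly in \<open>N\<close>, while
  the second factor does not depend on \<open>N\<close> once \<open>L\<^sub>h = 0\<close>.
\<close>

text \<open>By the recursion, \<open>\<Gamma> k\<close> is the product of the factors
  \<open>1 - \<alpha> j\<close> for \<open>2 \<le> j \<le> k\<close>, each strictly between 0 and 1;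
  the empty product at \<open>k = 1\<close> attains the upper bound.\<close>

lemma damping_product_bounds:
  fixes \<alpha> \<Gamma> :: "nat \<Rightarrow> real"
  assumes \<alpha>: "\<And>k. k \<ge> 2 \<Longrightarrow> 0 < \<alpha> k \<and> \<alpha> k < 1"
    and \<Gamma>1: "\<Gamma> 1 = 1"
    and \<Gamma>: "\<And>k. k \<ge> 2 \<Longrightarrow> \<Gamma> k = (1 - \<alpha> k) * \<Gamma> (k - 1)"
    and "k \<ge> 1"
  shows "0 < \<Gamma> k \<and> \<Gamma> k \<le> 1"
  using \<open>k \<ge> 1\<close>
proof (induction k rule: dec_induct)
  case base
  show ?case using \<Gamma>1 by simp
next
  case (step k)
  have "\<Gamma> (Suc k) = (1 - \<alpha> (Suc k)) * \<Gamma> k" and "0 < \<alpha> (Suc k)" "\<alpha> (Suc k) < 1"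
    using \<Gamma>[of "Suc k"] \<alpha>[of "Suc k"] step.hyps by auto
  then show ?case
    using step.IH by (simp add: mult_le_one)
qed

theorem theorem2:
  fixes L\<^sub>\<Psi> L\<^sub>h M c :: real
    and x\<^sub>0 x\<^sub>s :: "real ^ 'n"
    and h :: "real ^ 'n \<Rightarrow> real"
    and \<alpha> \<delta> \<omega> \<Gamma> :: "nat \<Rightarrow> real"
  assumes "L\<^sub>\<Psi> > 0"
    and "\<alpha> 1 = 1"
    and "\<And>k. k \<ge> 2 \<Longrightarrow> 0 < \<alpha> k \<and> \<alpha> k < 1"
    and "\<And>k. k \<ge> 1 \<Longrightarrow> \<delta> k > 0"
    and "\<And>k. k \<ge> 1 \<Longrightarrow> \<omega> k > 0"
    and "\<Gamma> 1 = 1"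
    and "\<And>k. k \<ge> 2 \<Longrightarrow> \<Gamma> k = (1 - \<alpha> k) * \<Gamma> (k - 1)"
    and "\<And>k. k \<ge> 1 \<Longrightarrow> \<alpha> k * \<delta> k \<le> \<omega> k \<and> \<omega> k < 1 / L\<^sub>\<Psi>"
    and "\<And>k. k \<ge> 1 \<Longrightarrow> \<alpha> k / (\<delta> k * \<Gamma> k) \<ge> \<alpha> (k + 1) / (\<delta> (k + 1) * \<Gamma> (k + 1))"
    and "c > 0"
    and "\<delta> 1 = c"
    and "\<And>k. k \<ge> 1 \<Longrightarrow> \<omega> k = c"
    and "has_lipschitz_gradient L\<^sub>h h"
    and "h = (\<lambda>x. 0)"
    and "L\<^sub>h = 0"
  shows "complexity_bound L\<^sub>\<Psi> L\<^sub>h M \<delta> \<omega> \<Gamma> x\<^sub>0 x\<^sub>s \<in> O(\<lambda>N. 1 / real N)"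
proof -
  \<comment> \<open>\<open>d\<close> is the summand at \<open>k = 1\<close>, where
    \<open>\<Gamma> 1 = 1\<close>, and so the smallest one; \<open>K\<close> is the second factor of
    the bound.\<close>
  define d where "d = c * (1 - L\<^sub>\<Psi> * c)"
  define K where "K = (norm (x\<^sub>0 - x\<^sub>s))\<^sup>2 / c"
  have "c < 1 / L\<^sub>\<Psi>"
    using assms(8,12)[of 1] by simp
  \<comment> \<open>The strict inequality \<open>c < 1 / L\<^sub>\<Psi>\<close> is essential:
    equality would give \<open>d = 0\<close> and no linear growth.\<close>
  then have d: "d > 0"
    using assms(1,10) by (simp add: d_def field_simps)
  have K: "K \<ge> 0"
    using assms(10) by (simp add: K_def)
  have "norm (complexity_bound L\<^sub>\<Psi> L\<^sub>h M \<delta> \<omega> \<Gamma> x\<^sub>0 x\<^sub>s N) \<le> K / d * norm (1 / real N)"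
    if "N \<ge> 1" for N
  proof -
    define S where "S = (\<Sum>k=1..N. inverse (\<Gamma> k) * \<omega> k * (1 - L\<^sub>\<Psi> * \<omega> k))"
    have "d \<le> inverse (\<Gamma> k) * \<omega> k * (1 - L\<^sub>\<Psi> * \<omega> k)" if "k \<in> {1..N}" for k
    proof -
      have "1 \<le> inverse (\<Gamma> k)"
        using damping_product_bounds[OF assms(3,6,7), of k] that by (simp add: one_le_inverse)
      then have "1 * d \<le> inverse (\<Gamma> k) * d"
        using d by (intro mult_right_mono) auto
      then show ?thesis
        using assms(12)[of k] that by (simp add: d_def mult.assoc)
    qed
    then have "real N * d \<le> S"
      using sum_bounded_below[of "{1..N}" d] by (simp add: S_def)
    \<comment> \<open>Comparing the quotients by \<open>S\<close> and \<open>real N * d\<close>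
      requires both denominators to be positive, hence \<open>N \<ge> 1\<close>.\<close>
    moreover have "0 < real N * d"
      using that d by simp
    ultimately have "K / S \<le> K / (real N * d)" and "0 < S"
      using K by (auto intro: divide_left_mono)
    \<comment> \<open>The term with \<open>1 / \<Gamma> N\<close> carries the factor
      \<open>L\<^sub>h = 0\<close>; the remaining numerator is \<open>K\<close> because
      \<open>\<delta> 1 = c\<close>.\<close>
    moreover have "complexity_bound L\<^sub>\<Psi> L\<^sub>h M \<delta> \<omega> \<Gamma> x\<^sub>0 x\<^sub>s N = K / S"
      unfolding complexity_bound_def S_def K_def assms(11,15) by (simp add: divide_inverse)
    ultimately show ?thesis
      using K by (simp add: mult.commute)
  qed
  then show ?thesis
    by (intro bigoI[where c = "K / d"] eventually_sequentiallyI[of 1])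
qed

end
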